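(* Let $\mathbb{F}$ be a field with more than $2$ elements, let $G=([n],E)$ be a directed graph and $\mathcal{S}_G=\langle\mathrm{E}_{i,j}\mid (i,j)\in E\rangle\le\mathrm{M}(n,\mathbb{F})$. The following are equivalent: (1) $G$ is vertex-transitive; (2) $\mathcal{S}_G$ is conjugacy irreducible; (3) $\mathcal{S}_G$ is congruence irreducible.
   Context: Directed graph: $E\subseteq[n]\times[n]$. $G$ is vertex-transitive if its automorphism group (permutations $\sigma$ of $[n]$ with $(i,j)\in E\iff(\sigma(i),\sigma(j))\in E$) acts transitively on $[n]$. A matrix group $\mathcal{G}\le\mathrm{GL}(n,\mathbb{F})$ is irreducible if there is no subspace $0\ne U<\mathbb{F}^n$ invariant under all $A\in\mathcal{G}$. For $\mathcal{S}\le\mathrm{M}(n,\mathbb{F})$, $\mathrm{Conj}(\mathcal{S})=\{T\in\mathrm{GL}(n,\mathbb{F})\mid T\mathcal{S}T^{-1}=\mathcal{S}\}$ and $\mathrm{Cong}(\mathcal{S})=\{T\in\mathrm{GL}(n,\mathbb{F})\mid T\mathcal{S}T^t=\mathcal{S}\}$; $\mathcal{S}$ is conjugacy (resp. congruence) irreducible if $\mathrm{Conj}(\mathcal{S})$ (resp. $\mathrm{Cong}(\mathcal{S})$) is irreducible. $\mathrm{E}_{i,j}$ is the elementary matrix with $1$ at $(i,j)$. *)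

theory Defs
  imports "HOL-Analysis.Cartesian_Space"
begin

text \<open>The vertex set \<open>[n]\<close> is the universe of a finite type \<open>'n\<close>, so a directed graph
  (loops allowed) on it is an arbitrary binary relation \<open>E :: ('n \<times> 'n) set\<close>.\<close>

definition digraph_automorphism :: "('n \<times> 'n) set \<Rightarrow> ('n \<Rightarrow> 'n) \<Rightarrow> bool" where
  "digraph_automorphism E \<sigma> \<longleftrightarrow> bij \<sigma> \<and> (\<forall>i j. (i, j) \<in> E \<longleftrightarrow> (\<sigma> i, \<sigma> j) \<in> E)"

definition vertex_transitive :: "('n \<times> 'n) set \<Rightarrow> bool" where
  "vertex_transitive E \<longleftrightarrow> (\<forall>i j. \<exists>\<sigma>. digraph_automorphism E \<sigma> \<and> \<sigma> i = j)"

text \<open>On \<open>'a ^ 'n ^ 'n\<close> the library operation \<open>*s\<close> would take its scalars from \<open>'a ^ 'n\<close>;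
  the vector space structure over the field \<open>'a\<close> is therefore introduced here.\<close>

definition mat_scale :: "'a::field \<Rightarrow> 'a ^ 'n ^ 'm \<Rightarrow> 'a ^ 'n ^ 'm" where
  "mat_scale c A = (\<chi> i j. c * A $ i $ j)"

interpretation mat_space: vector_space "mat_scale :: 'a::field \<Rightarrow> 'a ^ 'n ^ 'm \<Rightarrow> 'a ^ 'n ^ 'm"
  by unfold_locales (simp_all add: mat_scale_def vec_eq_iff algebra_simps)

definition elem_mat :: "'n \<Rightarrow> 'n \<Rightarrow> 'a::field ^ 'n ^ 'n" where
  "elem_mat i j = (\<chi> k l. if k = i \<and> l = j then 1 else 0)"

definition graph_space :: "('n \<times> 'n) set \<Rightarrow> ('a::field ^ 'n ^ 'n) set" where
  "graph_space E = mat_space.span {elem_mat i j | i j. (i, j) \<in> E}"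

definition irreducible_matrices :: "('a::field ^ 'n ^ 'n) set \<Rightarrow> bool" where
  "irreducible_matrices \<G> \<longleftrightarrow>
     \<not> (\<exists>U. vec.subspace U \<and> U \<noteq> {0} \<and> U \<noteq> UNIV \<and> (\<forall>A\<in>\<G>. \<forall>u\<in>U. A *v u \<in> U))"

definition Conj :: "('a::field ^ 'n ^ 'n) set \<Rightarrow> ('a ^ 'n ^ 'n) set" where
  "Conj S = {T. invertible T \<and> (\<lambda>A. T ** A ** matrix_inv T) ` S = S}"

definition Cong :: "('a::field ^ 'n ^ 'n) set \<Rightarrow> ('a ^ 'n ^ 'n) set" where
  "Cong S = {T. invertible T \<and> (\<lambda>A. T ** A ** transpose T) ` S = S}"

definition conjugacy_irreducible :: "('a::field ^ 'n ^ 'n) set \<Rightarrow> bool" where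
  "conjugacy_irreducible S \<longleftrightarrow> irreducible_matrices (Conj S)"

definition congruence_irreducible :: "('a::field ^ 'n ^ 'n) set \<Rightarrow> bool" where
  "congruence_irreducible S \<longleftrightarrow> irreducible_matrices (Cong S)"

end

(* If G is vertex-transitive, Conj and Cong contain the invertible diagonal matrices and the
   permutation matrices of automorphisms. A diagonal matrix with one entry c \<noteq> 0, 1 extracts a
   basis vector from any nonzero invariant subspace, and transitivity then yields all of them.

   Conversely, preorder the vertices by x \<le> y iff N+(y) \<subseteq> N+(x) and N-(x) \<subseteq> N-(y) (for congruence,
   iff N+(y) \<subseteq> N+(x) and N-(y) \<subseteq> N-(x)). The matrices supported on this preorder form an algebra
   defined by stabilizers of S_G, so every T in Conj (resp. Cong) normalizes it and maps the
   coordinate subspace of a down-set x\<down> onto that of some y\<down>; in particular the two have the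
   same size. Hence {x. |x\<down>| \<le> c} spans an invariant subspace, and irreducibility forces all x\<down> to
   have the same size: the preorder is an equivalence relation, whose classes consist of twins and
   are permuted by T. This permutation of classes lifts to an automorphism of G, so the orbits of the
   automorphism group also span invariant subspaces, and there is only one orbit. *)

theory Submission imports Defs "HOL-Combinatorics.Transposition" begin

hide_const (open) Transposition.transpose

section \<open>Graph spaces as spaces of matrices with prescribed support\<close>

text \<open>The matrices with the required support form a subspace containing the generators, and
  every matrix is the combination of elementary matrices given by its entries. From here on
  membership is a question about supports only.\<close>

lemma mem_graph_space_iff:
  fixes A :: "'a::field ^ 'n::finite ^ 'n"
  shows "A \<in> graph_space E \<longleftrightarrow> (\<forall>i j. A $ i $ j \<noteq> 0 \<longrightarrow> (i, j) \<in> E)"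
proof
  have "graph_space E \<subseteq> {A :: 'a ^ 'n ^ 'n. \<forall>i j. A $ i $ j \<noteq> 0 \<longrightarrow> (i, j) \<in> E}"
    unfolding graph_space_def
    by (rule mat_space.span_minimal)
      (auto simp: elem_mat_def mat_space.subspace_def mat_scale_def split: if_splits; force)+
  then show "A \<in> graph_space E \<Longrightarrow> \<forall>i j. A $ i $ j \<noteq> 0 \<longrightarrow> (i, j) \<in> E"
    by blast
next
  assume A: "\<forall>i j. A $ i $ j \<noteq> 0 \<longrightarrow> (i, j) \<in> E"
  have A_sum: "A = (\<Sum>i\<in>UNIV. \<Sum>j\<in>UNIV. mat_scale (A $ i $ j) (elem_mat i j))"
    by (simp add: vec_eq_iff mat_scale_def elem_mat_def if_distrib[of "\<lambda>x. _ * x"]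
        sum.If_cases flip: if_if_eq_conj cong: if_cong)
  have "mat_scale (A $ i $ j) (elem_mat i j) \<in> graph_space E" for i j
  proof (cases "(i, j) \<in> E")
    case True
    then show ?thesis
      unfolding graph_space_def by (intro mat_space.span_scale mat_space.span_base) blast
  next
    case False
    then have "A $ i $ j = 0" using A by blast
    then have *: "mat_scale (A $ i $ j) (elem_mat i j) = (0 :: 'a ^ 'n ^ 'n)"
      by (simp add: mat_scale_def vec_eq_iff)
    show ?thesis
      unfolding * graph_space_def by (rule mat_space.span_zero)
  qed
  then show "A \<in> graph_space E"
    unfolding graph_space_def by (subst A_sum) (intro mat_space.span_sum)
qed

section \<open>Rank-one matrices and matrix inverses\<close>

text \<open>Two-sided multiplication acts on the two factors separately, so rank-one matrices
  isolate a single column of the left multiplier and a single row of the right one.\<close>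

definition outer_prod :: "'a::field ^ 'm \<Rightarrow> 'a ^ 'n \<Rightarrow> 'a ^ 'n ^ 'm" where
  "outer_prod u v = (\<chi> i j. u $ i * v $ j)"

lemma outer_prod_nth [simp]: "outer_prod u v $ i $ j = u $ i * v $ j"
  by (simp add: outer_prod_def)

lemma mult_outer_prod:
  fixes P :: "'a::field ^ 'n::finite ^ 'm::finite" and Q :: "'a ^ 'q::finite ^ 'p::finite"
  shows "P ** outer_prod u v ** Q = outer_prod (P *v u) (v v* Q)"
  by (simp add: vec_eq_iff matrix_matrix_mult_def matrix_vector_mult_def vector_matrix_mult_def
      sum_distrib_left sum_distrib_right mult_ac)

lemma axis_vector_matrix_mult:
  fixes Q :: "'a::field ^ 'n::finite ^ 'm::finite"
  shows "axis l 1 v* Q = Q $ l"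
  by (simp add: vec_eq_iff vector_matrix_mult_def axis_def if_distrib if_distribR cong: if_cong)

lemma matrix_vector_mult_axis:
  fixes P :: "'a::field ^ 'n::finite ^ 'm::finite"
  shows "P *v axis k 1 = column k P"
  by (simp add: vec_eq_iff matrix_vector_mult_def axis_def column_def if_distrib cong: if_cong)

lemma matrix_matrix_mult_nonzeroE:
  fixes A :: "'a::field ^ 'n::finite ^ 'm::finite" and B :: "'a ^ 'q::finite ^ 'n"
  assumes "(A ** B) $ i $ j \<noteq> 0"
  obtains k where "A $ i $ k \<noteq> 0" "B $ k $ j \<noteq> 0"
proof -
  have "\<exists>k. A $ i $ k * B $ k $ j \<noteq> 0"
  proof (rule ccontr)
    assume "\<not> ?thesis"
    then have "A $ i $ k * B $ k $ j = 0" for k by blast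
    then have "(A ** B) $ i $ j = 0"
      unfolding matrix_matrix_mult_def by (simp only: vec_lambda_beta sum.neutral_const)
    then show False using assms by simp
  qed
  then show ?thesis using that by auto
qed

text \<open>The diagonal entry 1 of the product is a sum in which some term must be nonzero. Such
  positions later replace the nonzero entries of a permutation matrix.\<close>

lemma matrix_inverse_entryE:
  fixes A B :: "'a::field ^ 'n::finite ^ 'n"
  assumes "A ** B = mat 1"
  obtains j where "A $ i $ j \<noteq> 0" "B $ j $ i \<noteq> 0"
proof -
  have "(A ** B) $ i $ i \<noteq> 0" using assms by (simp add: mat_def)
  then show ?thesis by (rule matrix_matrix_mult_nonzeroE) (rule that)
qed

lemma row_inverse_mult:
  fixes Q Q' :: "'a::field ^ 'n::finite ^ 'n"
  assumes "Q ** Q' = mat 1"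
  shows "Q $ l v* Q' = axis l 1"
  using assms
  by (auto simp: vec_eq_iff matrix_matrix_mult_def vector_matrix_mult_def mat_def axis_def mult.commute)

lemma column_inverse_mult:
  fixes P P' :: "'a::field ^ 'n::finite ^ 'n"
  assumes "P ** P' = mat 1"
  shows "P *v column k P' = axis k 1"
  using assms
  by (auto simp: vec_eq_iff matrix_matrix_mult_def matrix_vector_mult_def mat_def axis_def column_def)

lemma image_mult_inverse:
  fixes P :: "'a::field ^ 'n::finite ^ 'n"
  assumes "(\<lambda>A. P ** A ** Q) ` S = S" "P' ** P = mat 1" "Q ** Q' = mat 1"
  shows "(\<lambda>A. P' ** A ** Q') ` S = S"
proof -
  have "P' ** (P ** A ** Q) ** Q' = (P' ** P) ** A ** (Q ** Q')" for A
    by (simp add: matrix_mul_assoc)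
  then have "P' ** (P ** A ** Q) ** Q' = A" for A
    by (simp add: assms(2,3))
  then have "(\<lambda>A. P' ** A ** Q') ` (\<lambda>A. P ** A ** Q) ` S = S"
    by (simp add: image_image)
  then show ?thesis using assms(1) by simp
qed

lemma matrix_inv_inverse:
  fixes T :: "'a::field ^ 'n::finite ^ 'n"
  assumes "invertible T"
  shows "T ** matrix_inv T = mat 1" "matrix_inv T ** T = mat 1"
    "invertible (matrix_inv T)" "matrix_inv (matrix_inv T) = T"
proof -
  show *: "T ** matrix_inv T = mat 1" "matrix_inv T ** T = mat 1"
    using assms unfolding invertible_def matrix_inv_def by (metis (mono_tags, lifting) someI_ex)+
  then show inv: "invertible (matrix_inv T)" unfolding invertible_def by blast
  then have **: "matrix_inv T ** matrix_inv (matrix_inv T) = mat 1"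
    unfolding invertible_def matrix_inv_def[of "matrix_inv T"] by (metis (mono_tags, lifting) someI_ex)
  show "matrix_inv (matrix_inv T) = T"
    using arg_cong[OF **, of "(**) T"] * by (simp add: matrix_mul_assoc)
qed

lemma matrix_inv_unique:
  fixes T :: "'a::field ^ 'n::finite ^ 'n"
  assumes "T ** B = mat 1" "B ** T = mat 1"
  shows "matrix_inv T = B"
proof -
  have "T ** matrix_inv T = mat 1"
    using assms by (intro matrix_inv_inverse(1)) (auto simp: invertible_def)
  from arg_cong[OF this, of "(**) B"] show ?thesis
    using assms(2) by (simp add: matrix_mul_assoc)
qed

section \<open>Coordinate subspaces and irreducibility\<close>

definition coord_subspace :: "'n set \<Rightarrow> ('a::field ^ 'n) set" where
  "coord_subspace W = {x. \<forall>i. i \<notin> W \<longrightarrow> x $ i = 0}"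

lemma matrix_vector_mult_coord_subspace:
  fixes T :: "'a::field ^ 'n::finite ^ 'n"
  assumes "\<And>i j. T $ i $ j \<noteq> 0 \<Longrightarrow> j \<in> V \<Longrightarrow> i \<in> W" "x \<in> coord_subspace V"
  shows "T *v x \<in> coord_subspace W"
  unfolding coord_subspace_def
proof (intro CollectI allI impI)
  fix i assume "i \<notin> W"
  then have "T $ i $ j * x $ j = 0" for j
    using assms unfolding coord_subspace_def by (cases "j \<in> V") auto
  then show "(T *v x) $ i = 0"
    unfolding matrix_vector_mult_def by (simp only: vec_lambda_beta sum.neutral_const)
qed

text \<open>\<open>T\<close> embeds the coordinate subspace of \<open>V\<close> into that of
  \<open>W\<close>; compare dimensions.\<close>

lemma card_le_if_invertible:
  fixes T :: "'a::field ^ 'n::finite ^ 'n"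
  assumes "invertible T" "\<And>i j. T $ i $ j \<noteq> 0 \<Longrightarrow> j \<in> V \<Longrightarrow> i \<in> W"
  shows "card V \<le> card W"
proof -
  have "inj ((*v) T)"
    using assms(1) by (rule inj_matrix_vector_mult)
  then have "vec.dim ((*v) T ` coord_subspace V) = vec.dim (coord_subspace V :: ('a ^ 'n) set)"
    by (intro vec.dim_image_eq matrix_vector_mul_linear_gen) (auto intro: inj_on_subset)
  moreover have "vec.dim ((*v) T ` coord_subspace V) \<le> vec.dim (coord_subspace W :: ('a ^ 'n) set)"
    by (intro vec.dim_subset image_subsetI matrix_vector_mult_coord_subspace assms(2))
  ultimately show ?thesis
    by (simp add: coord_subspace_def dim_substandard_cart)
qed

text \<open>The coordinate subspace of \<open>W\<close> is invariant and contains the basis vector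
  of \<open>w\<close>. This makes irreducibility a combinatorial test on sets of vertices.\<close>

lemma irreducible_matrices_support:
  fixes G :: "('a::field ^ 'n::finite ^ 'n) set"
  assumes "irreducible_matrices G"
    and "\<And>T i j. T \<in> G \<Longrightarrow> T $ i $ j \<noteq> 0 \<Longrightarrow> j \<in> W \<Longrightarrow> i \<in> W"
    and "w \<in> W"
  shows "W = UNIV"
proof -
  let ?U = "coord_subspace W :: ('a ^ 'n) set"
  have sub: "vec.subspace ?U"
    unfolding coord_subspace_def vec.subspace_def by auto
  have mem: "axis i 1 \<in> ?U \<longleftrightarrow> i \<in> W" for i
    by (auto simp: coord_subspace_def axis_def)
  have "axis w 1 \<in> ?U" using mem assms(3) by blast
  moreover have "axis w 1 \<noteq> (0 :: 'a ^ 'n)" by simp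
  ultimately have "?U \<noteq> {0}" by blast
  moreover have "\<forall>T\<in>G. \<forall>u\<in>?U. T *v u \<in> ?U"
    using assms(2) by (auto intro: matrix_vector_mult_coord_subspace[of _ W])
  ultimately have "?U = UNIV"
    using assms(1) sub unfolding irreducible_matrices_def by blast
  then show ?thesis using mem by blast
qed

section \<open>Class permutations, graph automorphisms and twins\<close>

text \<open>Fixing a numbering of each class, \<open>\<sigma> x\<close> is the element of the class of \<open>f x\<close> with the same
  number as \<open>x\<close>.\<close>

lemma exists_class_permutation:
  fixes f :: "'n::finite \<Rightarrow> 'n"
  assumes "equivp r" "\<And>x y. card {z. r z x} = card {z. r z y}"
    and "\<And>x y. r (f x) (f y) \<Longrightarrow> r x y"
  obtains \<sigma> where "bij \<sigma>" "\<And>x. r (\<sigma> x) (f x)"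
proof -
  define C where "C x = {z. r z x}" for x
  have C_eq: "C x = C y" if "r x y" for x y
    using that assms(1) unfolding C_def by (metis equivp_symp equivp_transp)
  have C_self: "x \<in> C x" for x
    using assms(1) unfolding C_def by (simp add: equivp_reflp)
  define h where "h A = (SOME g. bij_betw g A {..<card A})" for A :: "'n set"
  have h: "bij_betw (h A) A {..<card A}" for A
    unfolding h_def lessThan_atLeast0 by (rule someI_ex[OF ex_bij_betw_finite_nat]) simp
  have "\<exists>y\<in>C (f x). h (C (f x)) y = h (C x) x" for x
  proof -
    have "h (C x) x \<in> {..<card (C x)}" using h C_self by (metis bij_betwE)
    moreover have "card (C x) = card (C (f x))" using assms(2) by (simp add: C_def)
    ultimately show ?thesis using h[of "C (f x)"] by (metis bij_betw_def imageE)
  qed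
  then obtain \<sigma> where \<sigma>: "\<And>x. \<sigma> x \<in> C (f x)" "\<And>x. h (C (f x)) (\<sigma> x) = h (C x) x"
    by metis
  have "inj \<sigma>"
  proof (rule injI)
    fix x y assume eq: "\<sigma> x = \<sigma> y"
    \<comment> \<open>Both \<open>f x\<close> and \<open>f y\<close> lie in the class of the common
      value, so \<open>x\<close> and \<open>y\<close> share a class; there their numbers
      agree.\<close>
    have "r (f x) (f y)"
      using \<sigma>(1)[of x] \<sigma>(1)[of y] eq assms(1) unfolding C_def
      by (metis equivp_symp equivp_transp mem_Collect_eq)
    then have "C (f x) = C (f y)" "C x = C y" using C_eq assms(3) by blast+
    then have "h (C x) x = h (C x) y" using \<sigma>(2)[of x] \<sigma>(2)[of y] eq by simp
    then show "x = y"
      using h[of "C x"] C_self[of x] C_self[of y] \<open>C x = C y\<close> by (metis bij_betw_def inj_onD)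
  qed
  then have "bij \<sigma>" by (simp add: bij_betw_def finite_UNIV_inj_surj)
  then show ?thesis using that \<sigma>(1) by (simp add: C_def)
qed

text \<open>An injective self-map of the finite edge set is onto, which gives the converse
  implication.\<close>

lemma digraph_automorphismI:
  fixes \<sigma> :: "'n::finite \<Rightarrow> 'n"
  assumes "bij \<sigma>" "\<And>i j. (i, j) \<in> E \<Longrightarrow> (\<sigma> i, \<sigma> j) \<in> E"
  shows "digraph_automorphism E \<sigma>"
proof -
  have inj: "inj (map_prod \<sigma> \<sigma>)"
    using assms(1) by (simp add: bij_is_inj prod.inj_map)
  have "map_prod \<sigma> \<sigma> ` E \<subseteq> E" using assms(2) by auto
  moreover have "finite E" by simp
  ultimately have "map_prod \<sigma> \<sigma> ` E = E"
    using inj_on_subset[OF inj] by (intro endo_inj_surj) auto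
  then have "(i, j) \<in> E" if "(\<sigma> i, \<sigma> j) \<in> E" for i j
    using that inj_image_mem_iff[OF inj, of "(i, j)" E] by simp
  then show ?thesis using assms unfolding digraph_automorphism_def by blast
qed

lemma digraph_automorphism_comp:
  assumes "digraph_automorphism E \<sigma>" "digraph_automorphism E \<tau>"
  shows "digraph_automorphism E (\<sigma> \<circ> \<tau>)"
proof -
  have "(i, j) \<in> E \<longleftrightarrow> (\<sigma> (\<tau> i), \<sigma> (\<tau> j)) \<in> E" for i j
  proof -
    have "(i, j) \<in> E \<longleftrightarrow> (\<tau> i, \<tau> j) \<in> E"
      using assms(2) unfolding digraph_automorphism_def by blast
    also have "\<dots> \<longleftrightarrow> (\<sigma> (\<tau> i), \<sigma> (\<tau> j)) \<in> E"
      using assms(1) unfolding digraph_automorphism_def by blast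
    finally show ?thesis .
  qed
  moreover have "bij (\<sigma> \<circ> \<tau>)"
    using assms unfolding digraph_automorphism_def by (blast intro: bij_comp)
  ultimately show ?thesis unfolding digraph_automorphism_def comp_apply by blast
qed

text \<open>Since \<open>z\<close> may be \<open>x\<close> or \<open>y\<close> itself, loops and
  edges between the two are compared as well; this is what makes swapping them an
  automorphism.\<close>

definition twins :: "('n \<times> 'n) set \<Rightarrow> 'n \<Rightarrow> 'n \<Rightarrow> bool" where
  "twins E x y \<longleftrightarrow> (\<forall>z. ((x, z) \<in> E \<longleftrightarrow> (y, z) \<in> E) \<and> ((z, x) \<in> E \<longleftrightarrow> (z, y) \<in> E))"

text \<open>Every vertex is a twin of its image, so the endpoints of an edge can be replaced one
  after the other.\<close>

lemma digraph_automorphism_transpose: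
  fixes E :: "('n::finite \<times> 'n) set"
  assumes "twins E x y"
  shows "digraph_automorphism E (Transposition.transpose x y)"
proof (rule digraph_automorphismI)
  have "twins E z (Transposition.transpose x y z)" for z
    using assms by (auto simp: twins_def Transposition.transpose_def)
  then show "(Transposition.transpose x y i, Transposition.transpose x y j) \<in> E" if "(i, j) \<in> E" for i j
    using that unfolding twins_def by blast
qed simp

section \<open>From an irreducible matrix group to vertex-transitivity\<close>

text \<open>The common setting for \<open>Conj\<close> and \<open>Cong\<close>. The axiom \<open>normalizes\<close> says that \<open>T\<inverse> X T\<close> is
  supported on the preorder \<open>le\<close> for every elementary matrix \<open>X\<close> supported on it. The disjunction in
  \<open>edge\<close> covers both cases: the right factor is \<open>T\<inverse>\<close> for conjugacy and the transpose of \<open>T\<close> for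
  congruence.\<close>

locale graph_matrix_group =
  fixes E :: "('n::finite \<times> 'n) set" and le :: "'n \<Rightarrow> 'n \<Rightarrow> bool"
    and G :: "('a::field ^ 'n ^ 'n) set"
  assumes le_refl: "le x x"
    and le_trans: "le x y \<Longrightarrow> le y z \<Longrightarrow> le x z"
    and le_antisym: "le x y \<Longrightarrow> le y x \<Longrightarrow> twins E x y"
    and invertible: "T \<in> G \<Longrightarrow> invertible T"
    and inv_closed: "T \<in> G \<Longrightarrow> matrix_inv T \<in> G"
    and normalizes: "T \<in> G \<Longrightarrow> matrix_inv T $ k $ i' \<noteq> 0 \<Longrightarrow> le i' i \<Longrightarrow> T $ i $ j \<noteq> 0 \<Longrightarrow> le k j"
    and edge: "T \<in> G \<Longrightarrow>
      (\<And>m n. matrix_inv T $ m $ a \<noteq> 0 \<Longrightarrow> T $ b $ n \<noteq> 0 \<or> matrix_inv T $ n $ b \<noteq> 0 \<Longrightarrow> (m, n) \<in> E)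
      \<Longrightarrow> (a, b) \<in> E"
begin

lemma normalizes_inv:
  assumes "T \<in> G" "T $ k $ i' \<noteq> 0" "le i' i" "matrix_inv T $ i $ j \<noteq> 0"
  shows "le k j"
  using normalizes[OF inv_closed[OF assms(1)], of k i' i j] assms(2-)
  by (simp add: matrix_inv_inverse(4)[OF invertible[OF assms(1)]])

lemma pivotE:
  assumes "T \<in> G"
  obtains i where "T $ i $ j \<noteq> 0" "matrix_inv T $ j $ i \<noteq> 0"
  using matrix_inverse_entryE[OF matrix_inv_inverse(2)[OF invertible[OF assms]], of j] by blast

text \<open>The nonzero entry of \<open>T\<close> at the pivot makes the inverse send the coordinate
  subspace of the down-set of \<open>i\<close> into that of \<open>j\<close>; the nonzero entry of
  the inverse makes \<open>T\<close> send the latter back into the former.\<close>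

lemma card_down_pivot:
  assumes "T \<in> G" "T $ i $ j \<noteq> 0" "matrix_inv T $ j $ i \<noteq> 0"
  shows "card {x. le x i} = card {x. le x j}"
proof (rule antisym)
  show "card {x. le x i} \<le> card {x. le x j}"
    by (rule card_le_if_invertible[of "matrix_inv T"])
      (use assms normalizes matrix_inv_inverse(3)[OF invertible[OF assms(1)]] in blast)+
  show "card {x. le x j} \<le> card {x. le x i}"
    by (rule card_le_if_invertible[of T]) (use assms normalizes_inv invertible in blast)+
qed

context
  assumes irred: "irreducible_matrices G"
begin

text \<open>If \<open>T $ i $ j\<close> is nonzero and \<open>k\<close> is a pivot row of column
  \<open>j\<close>, then \<open>i\<close> is below \<open>k\<close>, whose down-set is as large as
  that of \<open>j\<close>. Hence the vertices with down-sets of bounded size pass the support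
  test.\<close>

lemma card_down_eq: "card {z. le z x} = card {z. le z y}"
proof -
  define d where "d x = card {z. le z x}" for x
  have d_mono: "d x \<le> d y" if "le x y" for x y
    unfolding d_def by (rule card_mono[OF finite]) (use that le_trans in blast)
  have "d y \<le> d x" for x y
  proof -
    have "{y. d y \<le> d x} = UNIV"
    proof (rule irreducible_matrices_support[OF irred])
      fix T i j assume T: "T \<in> G" "T $ i $ j \<noteq> 0" and j: "j \<in> {y. d y \<le> d x}"
      obtain k where k: "T $ k $ j \<noteq> 0" "matrix_inv T $ j $ k \<noteq> 0"
        using pivotE T(1) by blast
      have "d i \<le> d k" using d_mono normalizes_inv T le_refl k(2) by blast
      also have "\<dots> = d j" unfolding d_def using card_down_pivot T(1) k by blast
      finally show "i \<in> {y. d y \<le> d x}" using j by simp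
    qed auto
    then show ?thesis by blast
  qed
  then show ?thesis unfolding d_def by (simp add: order_antisym)
qed

lemma le_sym:
  assumes "le x y"
  shows "le y x"
proof -
  have "{z. le z x} \<subseteq> {z. le z y}" using assms le_trans by blast
  then have "{z. le z x} = {z. le z y}"
    using card_down_eq by (intro card_subset_eq) auto
  then show ?thesis using le_refl by blast
qed

lemma twins_if_le: "le x y \<Longrightarrow> twins E x y"
  using le_sym le_antisym by blast

lemma equivp_le: "equivp le"
  by (intro equivpI reflpI sympI transpI) (blast intro: le_refl le_sym le_trans)+

text \<open>A choice \<open>f\<close> of pivot rows need not be injective, but it reflects
  \<open>le\<close>, so it can be corrected within the classes to a bijection. All nonzero entries
  of column \<open>j\<close> stay in the class of \<open>f j\<close>.\<close>

lemma exists_automorphism: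
  assumes "T \<in> G"
  obtains \<sigma> where "digraph_automorphism E \<sigma>" "\<And>i j. T $ i $ j \<noteq> 0 \<Longrightarrow> le i (\<sigma> j)"
proof -
  have "\<exists>i. T $ i $ j \<noteq> 0 \<and> matrix_inv T $ j $ i \<noteq> 0" for j
    using pivotE[OF assms, of j] by blast
  then obtain f where f: "\<And>j. T $ f j $ j \<noteq> 0" "\<And>j. matrix_inv T $ j $ f j \<noteq> 0"
    by metis
  have f_T: "le i (f j)" if "T $ i $ j \<noteq> 0" for i j
    using normalizes_inv assms that le_refl f(2) by blast
  have f_inv: "le i (f j)" if "matrix_inv T $ j $ i \<noteq> 0" for i j
    using normalizes_inv[OF assms f(1) le_refl that] le_sym by blast
  have f_refl: "le x y" if "le (f x) (f y)" for x y
    using normalizes[OF assms f(2) that f(1)] .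
  obtain \<sigma> where \<sigma>: "bij \<sigma>" "\<And>x. le (\<sigma> x) (f x)"
    using exists_class_permutation[OF equivp_le card_down_eq f_refl] by blast
  have \<sigma>_refl: "le k m" if "le (\<sigma> k) (f m)" for k m
    using that \<sigma>(2) f_refl le_sym le_trans by blast
  have "(\<sigma> k, \<sigma> l) \<in> E" if "(k, l) \<in> E" for k l
  \<comment> \<open>The entries tested by \<open>edge\<close> occur only at positions
    \<open>(m, n)\<close> with \<open>m\<close> a twin of \<open>k\<close> and \<open>n\<close> a
    twin of \<open>l\<close>, so they inherit the edge \<open>(k, l)\<close>.\<close>
  proof (rule edge[OF assms])
    fix m n assume "matrix_inv T $ m $ \<sigma> k \<noteq> 0"
      and "T $ \<sigma> l $ n \<noteq> 0 \<or> matrix_inv T $ n $ \<sigma> l \<noteq> 0"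
    then have "twins E k m" "twins E l n"
      using f_T f_inv \<sigma>_refl twins_if_le by blast+
    then show "(m, n) \<in> E" using that unfolding twins_def by blast
  qed
  then have "digraph_automorphism E \<sigma>" using \<sigma>(1) digraph_automorphismI by blast
  moreover have "le i (\<sigma> j)" if "T $ i $ j \<noteq> 0" for i j
    using f_T[OF that] \<sigma>(2) le_sym le_trans by blast
  ultimately show ?thesis using that by blast
qed

lemma vertex_transitive: "vertex_transitive E"
  unfolding vertex_transitive_def
proof (intro allI)
  fix v w
  define W where "W = {x. \<exists>\<sigma>. digraph_automorphism E \<sigma> \<and> \<sigma> v = x}"
  have "digraph_automorphism E id" by (simp add: digraph_automorphism_def)
  then have "v \<in> W" unfolding W_def by force
  moreover have "i \<in> W" if T: "T \<in> G" "T $ i $ j \<noteq> 0" "j \<in> W" for T i j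
  proof -
    obtain \<sigma> where \<sigma>: "digraph_automorphism E \<sigma>" "le i (\<sigma> j)"
      using exists_automorphism[OF T(1)] T(2) by blast
    obtain \<tau> where \<tau>: "digraph_automorphism E \<tau>" "\<tau> v = j"
      using T(3) unfolding W_def by blast
    \<comment> \<open>The map \<open>\<sigma> \<circ> \<tau>\<close> only reaches a twin of
      \<open>i\<close>; a final swap of the two twins corrects this.\<close>
    have "digraph_automorphism E (Transposition.transpose i (\<sigma> j) \<circ> (\<sigma> \<circ> \<tau>))"
      by (intro digraph_automorphism_comp digraph_automorphism_transpose twins_if_le \<sigma> \<tau>)
    moreover have "(Transposition.transpose i (\<sigma> j) \<circ> (\<sigma> \<circ> \<tau>)) v = i" using \<tau>(2) by simp
    ultimately show ?thesis unfolding W_def by blast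
  qed
  ultimately have "W = UNIV" using irreducible_matrices_support[OF irred] by blast
  then show "\<exists>\<sigma>. digraph_automorphism E \<sigma> \<and> \<sigma> v = w" unfolding W_def by blast
qed

end

end

section \<open>Two-sided multiplications preserving a graph space\<close>

text \<open>Independent multipliers \<open>P\<close> and \<open>Q\<close> cover conjugation and
  congruence at once and make the setting closed under transposition.\<close>

locale graph_space_equivalence =
  fixes E :: "('n::finite \<times> 'n) set" and P P' Q Q' :: "'a::field ^ 'n ^ 'n"
  assumes P: "P ** P' = mat 1" "P' ** P = mat 1" and Q: "Q ** Q' = mat 1" "Q' ** Q = mat 1"
    and stable: "(\<lambda>A. P ** A ** Q) ` graph_space E = graph_space E"
begin

lemma mult_mem: "A \<in> graph_space E \<Longrightarrow> P ** A ** Q \<in> graph_space E"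
  using stable by blast

lemma mult_inv_mem: "A \<in> graph_space E \<Longrightarrow> P' ** A ** Q' \<in> graph_space E"
  using image_mult_inverse[OF stable P(2) Q(1)] by blast

text \<open>Multiply the elementary matrix of \<open>(j, l)\<close> forward, read off row
  \<open>i\<close>, transplant it to row \<open>i'\<close>, which the inclusion of
  out-neighbourhoods permits, and multiply back. The row factor returns to a basis vector, while the
  column factor has become column \<open>i'\<close> of \<open>P'\<close>.\<close>

lemma out_neighbours:
  assumes "P' $ k $ i' \<noteq> 0" "P $ i $ j \<noteq> 0" "\<And>m. (i, m) \<in> E \<Longrightarrow> (i', m) \<in> E" "(j, l) \<in> E"
  shows "(k, l) \<in> E"
proof -
  have "outer_prod (axis j 1) (axis l 1) \<in> (graph_space E :: ('a ^ 'n ^ 'n) set)"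
    using assms(4) by (auto simp: mem_graph_space_iff axis_def)
  from mult_mem[OF this] have "outer_prod (column j P) (Q $ l) \<in> graph_space E"
    by (simp add: mult_outer_prod axis_vector_matrix_mult matrix_vector_mult_axis)
  then have "(i, m) \<in> E" if "Q $ l $ m \<noteq> 0" for m
    using that assms(2) by (auto simp: mem_graph_space_iff column_def)
  then have "outer_prod (axis i' 1) (Q $ l) \<in> graph_space E"
    using assms(3) by (auto simp: mem_graph_space_iff axis_def)
  from mult_inv_mem[OF this] have "outer_prod (column i' P') (axis l 1) \<in> graph_space E"
    by (simp add: mult_outer_prod row_inverse_mult[OF Q(1)] matrix_vector_mult_axis)
  then show ?thesis
    using assms(1) by (auto simp: mem_graph_space_iff column_def axis_def)
qed

text \<open>The elementary matrix of \<open>(a, b)\<close> is the image of the outer product of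
  column \<open>a\<close> of \<open>P'\<close> and row \<open>b\<close> of \<open>Q'\<close>, whose
  support lies in \<open>E\<close> by assumption.\<close>

lemma edge:
  assumes "\<And>m n. P' $ m $ a \<noteq> 0 \<Longrightarrow> Q' $ b $ n \<noteq> 0 \<Longrightarrow> (m, n) \<in> E"
  shows "(a, b) \<in> E"
proof -
  have "outer_prod (column a P') (Q' $ b) \<in> graph_space E"
    using assms by (auto simp: mem_graph_space_iff column_def)
  from mult_mem[OF this] have "outer_prod (axis a 1) (axis b 1) \<in> (graph_space E :: ('a ^ 'n ^ 'n) set)"
    by (simp add: mult_outer_prod row_inverse_mult[OF Q(2)] column_inverse_mult[OF P(1)])
  then show ?thesis by (auto simp: mem_graph_space_iff axis_def)
qed

end

lemma graph_space_converse:
  "graph_space (E\<inverse>) = transpose ` (graph_space E :: ('a::field ^ 'n::finite ^ 'n) set)"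
proof -
  have "A \<in> graph_space (E\<inverse>) \<longleftrightarrow> transpose A \<in> graph_space E"
    for A :: "'a ^ 'n ^ 'n"
    by (auto simp: mem_graph_space_iff Finite_Cartesian_Product.transpose_def)
  then show ?thesis by (force simp: image_iff intro: transpose_transpose[symmetric])
qed

text \<open>Transposition reverses products, so the left and right multipliers trade places together
  with in- and out-neighbours. This yields \<open>in_neighbours\<close> by duality.\<close>

lemma (in graph_space_equivalence) converse:
  "graph_space_equivalence (E\<inverse>)
    (transpose Q) (transpose Q')
    (transpose P) (transpose P')"
proof
  let ?t = "transpose :: 'a ^ 'n ^ 'n \<Rightarrow> _"
  have "(\<lambda>A. ?t Q ** A ** ?t P) ` ?t ` graph_space E = ?t ` (\<lambda>A. P ** A ** Q) ` graph_space E"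
    by (simp add: image_image matrix_transpose_mul matrix_mul_assoc)
  then show "(\<lambda>A. ?t Q ** A ** ?t P) ` graph_space (E\<inverse>) = graph_space (E\<inverse>)"
    by (simp add: graph_space_converse stable)
qed (use P Q in \<open>simp_all flip: matrix_transpose_mul\<close>)

lemma (in graph_space_equivalence) in_neighbours:
  assumes "Q' $ i' $ k \<noteq> 0" "Q $ j $ i \<noteq> 0" "\<And>m. (m, i) \<in> E \<Longrightarrow> (m, i') \<in> E" "(l, j) \<in> E"
  shows "(l, k) \<in> E"
  using graph_space_equivalence.out_neighbours[OF converse, of k i' i j l] assms
  by (auto simp: Finite_Cartesian_Product.transpose_def)

section \<open>Conjugacy or congruence irreducibility implies vertex-transitivity\<close>

lemma Conj_equivalence:
  fixes T :: "'a::field ^ 'n::finite ^ 'n"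
  assumes "T \<in> Conj (graph_space E)"
  shows "graph_space_equivalence E T (matrix_inv T) (matrix_inv T) T"
  using assms by unfold_locales (auto simp: Conj_def matrix_inv_inverse)

lemma transpose_matrix_inv:
  fixes T :: "'a::field ^ 'n::finite ^ 'n"
  assumes "invertible T"
  shows "transpose T ** transpose (matrix_inv T) = mat 1"
    "transpose (matrix_inv T) ** transpose T = mat 1"
  using matrix_inv_inverse[OF assms] by (simp_all flip: matrix_transpose_mul)

lemma Cong_equivalence:
  fixes T :: "'a::field ^ 'n::finite ^ 'n"
  assumes "T \<in> Cong (graph_space E)"
  shows "graph_space_equivalence E T (matrix_inv T)
    (transpose T) (transpose (matrix_inv T))"
  using assms by unfold_locales (auto simp: Cong_def matrix_inv_inverse transpose_matrix_inv)

lemma Conj_matrix_inv: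
  fixes T :: "'a::field ^ 'n::finite ^ 'n"
  assumes "T \<in> Conj S"
  shows "matrix_inv T \<in> Conj S"
proof -
  have inv: "invertible T" and S: "(\<lambda>A. T ** A ** matrix_inv T) ` S = S"
    using assms by (auto simp: Conj_def)
  show ?thesis
    using image_mult_inverse[OF S matrix_inv_inverse(2)[OF inv] matrix_inv_inverse(2)[OF inv]]
    by (simp add: Conj_def matrix_inv_inverse inv)
qed

lemma Cong_matrix_inv:
  fixes T :: "'a::field ^ 'n::finite ^ 'n"
  assumes "T \<in> Cong S"
  shows "matrix_inv T \<in> Cong S"
proof -
  have inv: "invertible T" and S: "(\<lambda>A. T ** A ** transpose T) ` S = S"
    using assms by (auto simp: Cong_def)
  show ?thesis
    using image_mult_inverse[OF S matrix_inv_inverse(2)[OF inv] transpose_matrix_inv(1)[OF inv]]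
    by (simp add: Cong_def matrix_inv_inverse inv)
qed

lemma conjugacy_irreducible_imp_vertex_transitive:
  assumes "conjugacy_irreducible (graph_space E :: ('a::field ^ 'n::finite ^ 'n) set)"
  shows "vertex_transitive E"
proof -
  \<comment> \<open>The right multiplier is the inverse of \<open>T\<close>, so for in-neighbours
    \<open>T\<close> and its inverse swap roles and the inclusion runs the opposite way.\<close>
  let ?le = "\<lambda>x y. \<forall>z. ((y, z) \<in> E \<longrightarrow> (x, z) \<in> E) \<and> ((z, x) \<in> E \<longrightarrow> (z, y) \<in> E)"
  interpret graph_matrix_group E ?le "Conj (graph_space E :: ('a ^ 'n ^ 'n) set)"
  proof
    fix T :: "'a ^ 'n ^ 'n" and k i' i j
    assume T: "T \<in> Conj (graph_space E)"
      and *: "matrix_inv T $ k $ i' \<noteq> 0" "?le i' i" "T $ i $ j \<noteq> 0"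
    interpret graph_space_equivalence E T "matrix_inv T" "matrix_inv T" T
      using T by (rule Conj_equivalence)
    show "?le k j"
      using out_neighbours[OF *(1,3)] in_neighbours[OF *(3,1)] *(2) by blast
  next
    fix T :: "'a ^ 'n ^ 'n" and a b
    assume T: "T \<in> Conj (graph_space E)"
      and *: "\<And>m n. matrix_inv T $ m $ a \<noteq> 0 \<Longrightarrow>
        T $ b $ n \<noteq> 0 \<or> matrix_inv T $ n $ b \<noteq> 0 \<Longrightarrow> (m, n) \<in> E"
    show "(a, b) \<in> E"
      using graph_space_equivalence.edge[OF Conj_equivalence[OF T]] * by blast
  qed (use Conj_matrix_inv in \<open>auto simp: Conj_def twins_def\<close>)
  show ?thesis
    using vertex_transitive assms unfolding conjugacy_irreducible_def by blast
qed

lemma congruence_irreducible_imp_vertex_transitive: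
  assumes "congruence_irreducible (graph_space E :: ('a::field ^ 'n::finite ^ 'n) set)"
  shows "vertex_transitive E"
proof -
  \<comment> \<open>The right multiplier is now the transpose of \<open>T\<close>, so rows and
    columns are swapped but not \<open>T\<close> and its inverse; both inclusions run the same
    way.\<close>
  let ?le = "\<lambda>x y. \<forall>z. ((y, z) \<in> E \<longrightarrow> (x, z) \<in> E) \<and> ((z, y) \<in> E \<longrightarrow> (z, x) \<in> E)"
  let ?t = "transpose :: 'a ^ 'n ^ 'n \<Rightarrow> _"
  have t: "?t A $ i $ j = A $ j $ i" for A i j
    by (simp add: transpose_def)
  interpret graph_matrix_group E ?le "Cong (graph_space E :: ('a ^ 'n ^ 'n) set)"
  proof
    fix T :: "'a ^ 'n ^ 'n" and k i' i j
    assume T: "T \<in> Cong (graph_space E)"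
      and *: "matrix_inv T $ k $ i' \<noteq> 0" "?le i' i" "T $ i $ j \<noteq> 0"
    interpret graph_space_equivalence E T "matrix_inv T" "?t T" "?t (matrix_inv T)"
      using T by (rule Cong_equivalence)
    show "?le k j"
      using out_neighbours[OF *(1,3)] in_neighbours[of i' k j i] * by (auto simp: t)
  next
    fix T :: "'a ^ 'n ^ 'n" and a b
    assume T: "T \<in> Cong (graph_space E)"
      and *: "\<And>m n. matrix_inv T $ m $ a \<noteq> 0 \<Longrightarrow>
        T $ b $ n \<noteq> 0 \<or> matrix_inv T $ n $ b \<noteq> 0 \<Longrightarrow> (m, n) \<in> E"
    show "(a, b) \<in> E"
      using graph_space_equivalence.edge[OF Cong_equivalence[OF T]] * by (auto simp: t)
  qed (use Cong_matrix_inv in \<open>auto simp: Cong_def twins_def\<close>)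
  show ?thesis
    using vertex_transitive assms unfolding congruence_irreducible_def by blast
qed

section \<open>Vertex-transitivity implies both irreducibilities\<close>

text \<open>Diagonal matrices (\<open>\<sigma> = id\<close>) and permutation matrices
  (\<open>d\<close> constantly 1) are members of one family, so one membership proof serves
  both.\<close>

definition monomial_mat :: "('n \<Rightarrow> 'n) \<Rightarrow> ('n \<Rightarrow> 'a::field) \<Rightarrow> 'a ^ 'n ^ 'n" where
  "monomial_mat \<sigma> d = (\<chi> i j. if i = \<sigma> j then d j else 0)"

lemma monomial_mat_id_mult: "(monomial_mat id d *v u) $ i = d i * u $ i"
  by (simp add: monomial_mat_def matrix_vector_mult_def if_distrib[of "\<lambda>x. x * _"] cong: if_cong)

lemma monomial_mat_inverse:
  fixes d :: "'n::finite \<Rightarrow> 'a::field"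
  assumes "bij \<sigma>" "\<And>i. d i \<noteq> 0"
  obtains B where "monomial_mat \<sigma> d ** B = mat 1" "B ** monomial_mat \<sigma> d = mat 1"
    "\<And>i j. B $ i $ j \<noteq> 0 \<Longrightarrow> j = \<sigma> i"
proof -
  define B :: "'a ^ 'n ^ 'n" where "B = (\<chi> i j. if j = \<sigma> i then inverse (d i) else 0)"
  have "(B ** monomial_mat \<sigma> d) $ i $ j = inverse (d i) * monomial_mat \<sigma> d $ \<sigma> i $ j" for i j
    by (simp add: B_def matrix_matrix_mult_def if_distrib[of "\<lambda>x. x * _"] cong: if_cong)
  then have "B ** monomial_mat \<sigma> d = mat 1"
    using assms(2) inj_eq[OF bij_is_inj[OF assms(1)]]
    by (simp add: vec_eq_iff monomial_mat_def mat_def)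
  moreover from this have "monomial_mat \<sigma> d ** B = mat 1"
    by (simp add: matrix_left_right_inverse)
  moreover have "\<And>i j. B $ i $ j \<noteq> 0 \<Longrightarrow> j = \<sigma> i"
    by (auto simp: B_def split: if_splits)
  ultimately show ?thesis using that by blast
qed

lemma mult_mem_graph_space_subset:
  fixes P Q :: "'a::field ^ 'n::finite ^ 'n"
  assumes "\<And>i j. (i, j) \<in> E \<Longrightarrow> \<forall>a b. P $ a $ i \<noteq> 0 \<longrightarrow> Q $ j $ b \<noteq> 0 \<longrightarrow> (a, b) \<in> E"
    and "A \<in> graph_space E"
  shows "P ** A ** Q \<in> graph_space E"
  unfolding mem_graph_space_iff
proof (intro allI impI)
  fix a b assume "(P ** A ** Q) $ a $ b \<noteq> 0"
  then obtain i j where "P $ a $ i \<noteq> 0" "A $ i $ j \<noteq> 0" "Q $ j $ b \<noteq> 0"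
    by (elim matrix_matrix_mult_nonzeroE) blast
  then show "(a, b) \<in> E" using assms by (auto simp: mem_graph_space_iff)
qed

text \<open>Each inclusion depends only on supports following \<open>\<sigma>\<close>, so
  \<open>Q\<close> may be the inverse or the transpose of a monomial matrix.\<close>

lemma image_mult_graph_space_eq:
  fixes P P' Q Q' :: "'a::field ^ 'n::finite ^ 'n"
  assumes "digraph_automorphism E \<sigma>" "P ** P' = mat 1" "Q' ** Q = mat 1"
    and "\<And>i j. P $ i $ j \<noteq> 0 \<Longrightarrow> i = \<sigma> j" "\<And>i j. P' $ i $ j \<noteq> 0 \<Longrightarrow> j = \<sigma> i"
    and "\<And>i j. Q $ i $ j \<noteq> 0 \<Longrightarrow> j = \<sigma> i" "\<And>i j. Q' $ i $ j \<noteq> 0 \<Longrightarrow> i = \<sigma> j"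
  shows "(\<lambda>A. P ** A ** Q) ` graph_space E = graph_space E"
proof
  have edge_iff: "(i, j) \<in> E \<longleftrightarrow> (\<sigma> i, \<sigma> j) \<in> E" for i j
    using assms(1) unfolding digraph_automorphism_def by blast
  show "(\<lambda>A. P ** A ** Q) ` graph_space E \<subseteq> graph_space E"
  proof (rule image_subsetI)
    fix A :: "'a ^ 'n ^ 'n" assume "A \<in> graph_space E"
    then show "P ** A ** Q \<in> graph_space E"
      using edge_iff assms(4,6) by (intro mult_mem_graph_space_subset) blast+
  qed
  show "graph_space E \<subseteq> (\<lambda>A. P ** A ** Q) ` graph_space E"
  proof
    fix A :: "'a ^ 'n ^ 'n" assume "A \<in> graph_space E"
    then have "P' ** A ** Q' \<in> graph_space E"
      using edge_iff assms(5,7) by (intro mult_mem_graph_space_subset) blast+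
    moreover have "P ** (P' ** A ** Q') ** Q = (P ** P') ** A ** (Q' ** Q)"
      by (simp add: matrix_mul_assoc)
    then have "P ** (P' ** A ** Q') ** Q = A" using assms(2,3) by simp
    ultimately show "A \<in> (\<lambda>A. P ** A ** Q) ` graph_space E"
      by (intro image_eqI) simp_all
  qed
qed

lemma monomial_mat_mem_Conj_Cong:
  fixes d :: "'n::finite \<Rightarrow> 'a::field"
  assumes "digraph_automorphism E \<sigma>" "\<And>i. d i \<noteq> 0"
  shows "monomial_mat \<sigma> d \<in> Conj (graph_space E)" "monomial_mat \<sigma> d \<in> Cong (graph_space E)"
proof -
  let ?t = "transpose :: 'a ^ 'n ^ 'n \<Rightarrow> _"
  define M where "M = monomial_mat \<sigma> d"
  have "bij \<sigma>" using assms(1) by (simp add: digraph_automorphism_def)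
  then obtain B where B: "M ** B = mat 1" "B ** M = mat 1" "\<And>i j. B $ i $ j \<noteq> 0 \<Longrightarrow> j = \<sigma> i"
    using monomial_mat_inverse[of \<sigma> d] assms(2) unfolding M_def by blast
  have M: "i = \<sigma> j" if "M $ i $ j \<noteq> 0" for i j
    using that by (auto simp: M_def monomial_mat_def split: if_splits)
  have inv: "invertible M" "matrix_inv M = B"
    using B matrix_inv_unique by (auto simp: invertible_def)
  have "(\<lambda>A. M ** A ** B) ` graph_space E = graph_space E"
    by (rule image_mult_graph_space_eq[OF assms(1) B(1) B(1) M B(3) B(3) M])
  then show "monomial_mat \<sigma> d \<in> Conj (graph_space E)"
    using inv by (simp add: Conj_def flip: M_def)
  have "?t B ** ?t M = mat 1" using B(1) by (simp flip: matrix_transpose_mul)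
  then have "(\<lambda>A. M ** A ** ?t M) ` graph_space E = graph_space E"
    by (rule image_mult_graph_space_eq[OF assms(1) B(1)])
      (use M B(3) in \<open>auto simp: Finite_Cartesian_Product.transpose_def\<close>)
  then show "monomial_mat \<sigma> d \<in> Cong (graph_space E)"
    using inv by (simp add: Cong_def flip: M_def)
qed

lemma vertex_transitive_imp_irreducible:
  fixes E :: "('n::finite \<times> 'n) set" and G :: "('a::field ^ 'n ^ 'n) set"
  assumes "infinite (UNIV :: 'a set) \<or> card (UNIV :: 'a set) > 2" "vertex_transitive E"
    and G: "\<And>\<sigma> d. digraph_automorphism E \<sigma> \<Longrightarrow> (\<And>i. d i \<noteq> 0) \<Longrightarrow> monomial_mat \<sigma> d \<in> G"
  shows "irreducible_matrices G"
  unfolding irreducible_matrices_def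
proof (rule notI, elim exE conjE)
  fix U :: "('a ^ 'n) set"
  assume sub: "vec.subspace U" and "U \<noteq> {0}" "U \<noteq> UNIV" and inv: "\<forall>A\<in>G. \<forall>u\<in>U. A *v u \<in> U"
  \<comment> \<open>Here the size of the field enters; the infinite case is separate because
    \<open>card\<close> is then 0.\<close>
  obtain c :: 'a where c: "c \<noteq> 0" "c \<noteq> 1"
  proof -
    have "\<not> UNIV \<subseteq> {0, 1 :: 'a}"
      using assms(1) card_mono[of "{0, 1 :: 'a}" UNIV] finite_subset[of UNIV "{0, 1 :: 'a}"] by auto
    then show ?thesis using that by blast
  qed
  obtain u where u: "u \<in> U" "u \<noteq> 0"
    using \<open>U \<noteq> {0}\<close> vec.subspace_0[OF sub] by blast
  then obtain i where i: "u $ i \<noteq> 0" by (auto simp: vec_eq_iff)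
  define b where "b = (c - 1) * u $ i"
  \<comment> \<open>Scaling coordinate \<open>i\<close> by \<open>c\<close> and subtracting
    \<open>u\<close> cancels all other coordinates; \<open>c \<noteq> 1\<close> keeps the remaining
    one nonzero, and \<open>c \<noteq> 0\<close> keeps the matrix in \<open>G\<close>.\<close>
  have "monomial_mat id (\<lambda>k. if k = i then c else 1) *v u - u \<in> U"
    using u(1) c(1) inv G[of id] by (intro vec.subspace_diff[OF sub]) (auto simp: digraph_automorphism_def)
  moreover have "monomial_mat id (\<lambda>k. if k = i then c else 1) *v u - u = ((c - 1) * u $ i) *s axis i 1"
    by (simp add: vec_eq_iff monomial_mat_id_mult axis_def algebra_simps)
  ultimately have "b *s axis i 1 \<in> U" unfolding b_def by (simp only:)
  then have "inverse b *s (b *s axis i 1) \<in> U"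
    by (rule vec.subspace_scale[OF sub])
  moreover have "b \<noteq> 0" using c(2) i by (simp add: b_def)
  ultimately have ei: "axis i 1 \<in> U"
    by (simp add: vector_smult_assoc)
  have "axis j 1 \<in> U" for j
  proof -
    obtain \<sigma> where \<sigma>: "digraph_automorphism E \<sigma>" "\<sigma> i = j"
      using assms(2) unfolding vertex_transitive_def by blast
    have "monomial_mat \<sigma> (\<lambda>_. 1) *v axis i 1 \<in> U"
      using inv ei G[OF \<sigma>(1)] by simp
    moreover have "monomial_mat \<sigma> (\<lambda>_. 1) *v axis i 1 = (axis j 1 :: 'a ^ 'n)"
      unfolding matrix_vector_mult_axis
      using \<sigma>(2) by (auto simp: column_def monomial_mat_def axis_def vec_eq_iff)
    ultimately show ?thesis by simp
  qed
  then have "(\<Sum>j\<in>UNIV. x $ j *s axis j 1) \<in> U" for x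
    by (intro vec.subspace_sum[OF sub] vec.subspace_scale[OF sub])
  then have "x \<in> U" for x by (simp add: basis_expansion)
  then show False using \<open>U \<noteq> UNIV\<close> by blast
qed

theorem theorem1p16:
  fixes E :: "('n::finite \<times> 'n) set"
  assumes "infinite (UNIV :: 'a::field set) \<or> card (UNIV :: 'a set) > 2"
  shows "(vertex_transitive E \<longleftrightarrow> conjugacy_irreducible (graph_space E :: ('a ^ 'n ^ 'n) set)) \<and>
         (conjugacy_irreducible (graph_space E :: ('a ^ 'n ^ 'n) set) \<longleftrightarrow>
            congruence_irreducible (graph_space E :: ('a ^ 'n ^ 'n) set))"
proof -
  have "conjugacy_irreducible (graph_space E :: ('a ^ 'n ^ 'n) set)" if "vertex_transitive E"
    unfolding conjugacy_irreducible_def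
    by (rule vertex_transitive_imp_irreducible[OF assms that monomial_mat_mem_Conj_Cong(1)])
  moreover have "congruence_irreducible (graph_space E :: ('a ^ 'n ^ 'n) set)" if "vertex_transitive E"
    unfolding congruence_irreducible_def
    by (rule vertex_transitive_imp_irreducible[OF assms that monomial_mat_mem_Conj_Cong(2)])
  ultimately show ?thesis
    using conjugacy_irreducible_imp_vertex_transitive congruence_irreducible_imp_vertex_transitive
    by blast
qed

end
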